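(* If the $\lambda$-term $M$ is strongly $\beta$-normalising, then there exist a typing context $\Gamma$ and a type $A$ such that $\Gamma\vdash_s M:A$ is derivable in $\Lambda_\cap^s$.
   Context: $\lambda$-terms: $M::=x\mid MM\mid\lambda x.M$ modulo $\alpha$-conversion; $M[x:=N]$ capture-avoiding substitution; $\beta$-reduction is the contextual closure of $(\lambda x.M)N\to M[x:=N]$; strongly normalising means all reduction sequences are finite. Types: $A::=\varphi\mid A\to A\mid A\cap A$. A typing context is a finite set of pairs $x:A$, where a variable may occur with several types; $\Gamma,x:A$ denotes $\Gamma\cup\{x:A\}$; $x\notin\Gamma$ means no $x:B$ lies in $\Gamma$. Rules of $\Lambda_\cap^s$ ($n\ge0$): (Ax) $\Gamma,x:A\vdash_s x:A$; $(\mathsf{Beta})^s$ from $\Gamma\vdash_s M[x:=N]N_1\dots N_n:A$ and $\Gamma\vdash_s N:B$ infer $\Gamma\vdash_s(\lambda x.M)NN_1\dots N_n:A$; $(\mathsf{L}\to)$ from $\Gamma\vdash_s N:A_1$ and $\Gamma,y:A_2\vdash_s yN_1\dots N_n:B$, with $y\notin FV(N_1)\cup\dots\cup FV(N_n)$, $y\notin\Gamma$, infer $\Gamma,x:A_1\to A_2\vdash_s xNN_1\dots N_n:B$; $(\mathsf{R}\to)$ from $\Gamma,x:A\vdash_s M:B$, $x\notin\Gamma$, infer $\Gamma\vdash_s\lambda x.M:A\to B$; $(\mathsf{L}\cap)$ from $\Gamma,x:A_1,x:A_2\vdash_s xN_1\dots N_n:B$ infer $\Gamma,x:A_1\cap A_2\vdash_s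 xN_1\dots N_n:B$; $(\mathsf{R}\cap)$ from $\Gamma\vdash_s M:A$ and $\Gamma\vdash_s M:B$ infer $\Gamma\vdash_s M:A\cap B$. *)

theory Defs
  imports "HOL-Library.FSet"
begin

text \<open>
  Terms modulo \<open>\<alpha>\<close>-conversion are represented by de Bruijn terms; dangling indices play the
  role of the free variable names.
\<close>

datatype trm = Var nat | App trm trm | Lam trm

text \<open>
  \<open>lift t k\<close> increments the indices \<open>\<ge> k\<close>.  \<open>subst t s k\<close> is the capture-avoiding substitution
  of \<open>s\<close> for \<open>k\<close> in \<open>t\<close>, where the binder of \<open>k\<close> disappears, so that the indices above \<open>k\<close> are
  decremented; the contractum \<open>M[x := N]\<close> of \<open>(\<lambda>x. M) N\<close> is \<open>subst M N 0\<close>.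
\<close>

primrec lift :: "trm \<Rightarrow> nat \<Rightarrow> trm" where
  "lift (Var i) k = (if i < k then Var i else Var (Suc i))"
| "lift (App s t) k = App (lift s k) (lift t k)"
| "lift (Lam t) k = Lam (lift t (Suc k))"

primrec subst :: "trm \<Rightarrow> trm \<Rightarrow> nat \<Rightarrow> trm" where
  "subst (Var i) s k = (if k < i then Var (i - 1) else if i = k then s else Var i)"
| "subst (App t u) s k = App (subst t s k) (subst u s k)"
| "subst (Lam t) s k = Lam (subst t (lift s 0) (Suc k))"

primrec FV :: "trm \<Rightarrow> nat set" where
  "FV (Var i) = {i}"
| "FV (App s t) = FV s \<union> FV t"
| "FV (Lam t) = {i. Suc i \<in> FV t}"

abbreviation Apps :: "trm \<Rightarrow> trm list \<Rightarrow> trm" (infixl "\<degree>\<degree>" 150) where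
  "M \<degree>\<degree> Ns \<equiv> foldl App M Ns"

inductive beta :: "trm \<Rightarrow> trm \<Rightarrow> bool" (infix "\<rightarrow>\<^sub>\<beta>" 50) where
  contract: "App (Lam M) N \<rightarrow>\<^sub>\<beta> subst M N 0"
| appL: "M \<rightarrow>\<^sub>\<beta> M' \<Longrightarrow> App M N \<rightarrow>\<^sub>\<beta> App M' N"
| appR: "N \<rightarrow>\<^sub>\<beta> N' \<Longrightarrow> App M N \<rightarrow>\<^sub>\<beta> App M N'"
| lam: "M \<rightarrow>\<^sub>\<beta> M' \<Longrightarrow> Lam M \<rightarrow>\<^sub>\<beta> Lam M'"

definition strongly_normalising :: "trm \<Rightarrow> bool" where
  "strongly_normalising M \<longleftrightarrow> (\<nexists>f :: nat \<Rightarrow> trm. f 0 = M \<and> (\<forall>i. f i \<rightarrow>\<^sub>\<beta> f (Suc i)))"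

datatype ty =
    Atom nat
  | Arrow ty ty (infixr "\<^bold>\<rightarrow>" 200)
  | Cap ty ty (infixl "\<^bold>\<inter>" 210)

type_synonym ctx = "(nat \<times> ty) fset"

definition fresh_ctx :: "nat \<Rightarrow> ctx \<Rightarrow> bool" where
  "fresh_ctx x \<Gamma> \<longleftrightarrow> (\<forall>B. (x, B) |\<notin>| \<Gamma>)"

text \<open>
  The context \<open>\<Gamma>\<close> as seen from below a binder.  The bound variable, index \<open>0\<close>, is fresh for it;
  this is the side condition \<open>x \<notin> \<Gamma>\<close> of rule \<open>R_arrow\<close>.
\<close>

definition lift_ctx :: "ctx \<Rightarrow> ctx" where
  "lift_ctx \<Gamma> = (\<lambda>(x, B). (Suc x, B)) |`| \<Gamma>"

inductive typing_s :: "ctx \<Rightarrow> trm \<Rightarrow> ty \<Rightarrow> bool" ("_ \<turnstile>\<^sub>s _ : _" [51, 51, 51] 50) where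
  Ax: "finsert (x, A) \<Gamma> \<turnstile>\<^sub>s Var x : A"
| Beta: "\<Gamma> \<turnstile>\<^sub>s subst M N 0 \<degree>\<degree> Ns : A \<Longrightarrow> \<Gamma> \<turnstile>\<^sub>s N : B \<Longrightarrow>
    \<Gamma> \<turnstile>\<^sub>s App (Lam M) N \<degree>\<degree> Ns : A"
| L_arrow: "\<Gamma> \<turnstile>\<^sub>s N : A1 \<Longrightarrow> finsert (y, A2) \<Gamma> \<turnstile>\<^sub>s Var y \<degree>\<degree> Ns : B \<Longrightarrow>
    y \<notin> (\<Union>P\<in>set Ns. FV P) \<Longrightarrow> fresh_ctx y \<Gamma> \<Longrightarrow>
    finsert (x, A1 \<^bold>\<rightarrow> A2) \<Gamma> \<turnstile>\<^sub>s App (Var x) N \<degree>\<degree> Ns : B"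
| R_arrow: "finsert (0, A) (lift_ctx \<Gamma>) \<turnstile>\<^sub>s M : B \<Longrightarrow> \<Gamma> \<turnstile>\<^sub>s Lam M : A \<^bold>\<rightarrow> B"
| L_cap: "finsert (x, A1) (finsert (x, A2) \<Gamma>) \<turnstile>\<^sub>s Var x \<degree>\<degree> Ns : B \<Longrightarrow>
    finsert (x, A1 \<^bold>\<inter> A2) \<Gamma> \<turnstile>\<^sub>s Var x \<degree>\<degree> Ns : B"
| R_cap: "\<Gamma> \<turnstile>\<^sub>s M : A \<Longrightarrow> \<Gamma> \<turnstile>\<^sub>s M : B \<Longrightarrow> \<Gamma> \<turnstile>\<^sub>s M : A \<^bold>\<inter> B"

end

theory Submission
  imports Defs
begin

text \<open>
  Call \<open>A\<close> a component of \<open>C\<close> if \<open>C\<close> is an iterated intersection one of whose members is \<open>A\<close>.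
  Typability is preserved when variables are renamed and each declaration is replaced by one
  whose type has the old type as a component.  This contains weakening, and it makes \<open>L_cap\<close>
  admissible for arbitrary subjects, so that the several types that a context gives to a variable
  can be merged into one before that variable is abstracted.

  A strongly normalising term is then typed together with all its subterms, by induction on its
  reducts and, inside, on the size of the subterm.  An abstraction and \<open>x N\<^sub>1 \<dots> N\<^sub>n\<close> are
  typed from their immediate subterms; a head redex \<open>(\<lambda>x. M) N N\<^sub>1 \<dots> N\<^sub>n\<close> is typed by \<open>Beta\<close>
  from its head reduct and \<open>N\<close>.
\<close>

section \<open>Renaming\<close>

definition up :: "(nat \<Rightarrow> nat) \<Rightarrow> nat \<Rightarrow> nat" where
  "up \<rho> i = (case i of 0 \<Rightarrow> 0 | Suc j \<Rightarrow> Suc (\<rho> j))"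

primrec rename :: "(nat \<Rightarrow> nat) \<Rightarrow> trm \<Rightarrow> trm" where
  "rename \<rho> (Var i) = Var (\<rho> i)"
| "rename \<rho> (App s t) = App (rename \<rho> s) (rename \<rho> t)"
| "rename \<rho> (Lam t) = Lam (rename (up \<rho>) t)"

lemma up_simps [simp]: "up \<rho> 0 = 0" "up \<rho> (Suc i) = Suc (\<rho> i)"
  by (simp_all add: up_def)

lemma up_id: "up (\<lambda>i. i) = (\<lambda>i. i)"
  by (rule ext) (simp add: up_def split: nat.split)

lemma rename_id: "rename (\<lambda>i. i) t = t"
  by (induction t) (simp_all add: up_id)

lemma up_comp: "up \<rho> \<circ> up \<sigma> = up (\<rho> \<circ> \<sigma>)"
  by (rule ext) (simp add: up_def split: nat.split)

lemma rename_rename: "rename \<rho> (rename \<sigma> t) = rename (\<rho> \<circ> \<sigma>) t"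
  by (induction t arbitrary: \<rho> \<sigma>) (simp_all add: up_comp)

lemma rename_cong: "(\<And>i. i \<in> FV t \<Longrightarrow> \<rho> i = \<sigma> i) \<Longrightarrow> rename \<rho> t = rename \<sigma> t"
proof (induction t arbitrary: \<rho> \<sigma>)
  case (Lam t)
  have "up \<rho> i = up \<sigma> i" if "i \<in> FV t" for i
    using Lam.prems that by (cases i) auto
  then have "rename (up \<rho>) t = rename (up \<sigma>) t" by (rule Lam.IH)
  then show ?case by simp
qed (simp, metis FV.simps(2) UnCI rename.simps(2))

lemma rename_Apps [simp]: "rename \<rho> (M \<degree>\<degree> Ns) = rename \<rho> M \<degree>\<degree> map (rename \<rho>) Ns"
  by (induction Ns arbitrary: M) simp_all

text \<open>With lifting as a renaming, its commutation laws reduce to composing functions on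
  indices.\<close>

lemma lift_eq_rename: "lift t k = rename (\<lambda>i. if i < k then i else Suc i) t"
proof (induction t arbitrary: k)
  case (Lam t)
  have "up (\<lambda>i. if i < k then i else Suc i) = (\<lambda>i. if i < Suc k then i else Suc i)"
    by (rule ext) (simp add: up_def split: nat.split)
  then show ?case using Lam by simp
qed auto

lemma rename_up_lift: "rename (up \<rho>) (lift t 0) = lift (rename \<rho> t) 0"
  by (simp add: lift_eq_rename rename_rename comp_def)

text \<open>Each abstraction crossed raises the substituted index by one, so the induction needs the
  statement under \<open>k\<close> binders, where \<open>N\<close> too is renamed below
  \<open>k\<close> binders.\<close>

lemma rename_upn_subst:
  "rename ((up ^^ k) \<rho>) (subst M N k) =
    subst (rename ((up ^^ Suc k) \<rho>) M) (rename ((up ^^ k) \<rho>) N) k"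
proof (induction M arbitrary: N k)
  case (Var i)
  have upn: "(up ^^ n) \<rho> j = (if j < n then j else \<rho> (j - n) + n)" for n j
    by (induction n arbitrary: j) (auto simp: up_def split: nat.split)
  show ?case by (auto simp: upn simp del: funpow.simps)
next
  case (Lam M)
  from Lam [of "Suc k" "lift N 0"] show ?case by (simp add: rename_up_lift)
qed simp

lemma rename_subst: "rename \<rho> (subst M N 0) = subst (rename (up \<rho>) M) (rename \<rho> N) 0"
  using rename_upn_subst [of 0] by simp

lemma finite_FV: "finite (FV t)"
proof (induction t)
  case (Lam t)
  then have "finite (Suc -` FV t)" by (rule finite_vimageI) simp
  then show ?case by (simp add: vimage_def)
qed simp_all

lemma ex_fresh: "\<exists>y. y \<notin> (\<Union>P\<in>set Ns. FV P) \<and> fresh_ctx y \<Gamma>"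
proof -
  have "finite ((\<Union>P\<in>set Ns. FV P) \<union> fst ` fset \<Gamma>)"
    by (simp add: finite_FV)
  then obtain y where "y \<notin> (\<Union>P\<in>set Ns. FV P) \<union> fst ` fset \<Gamma>"
    using ex_new_if_finite infinite_UNIV_nat by blast
  then show ?thesis
    unfolding fresh_ctx_def by force
qed

section \<open>Weakening up to intersection components\<close>

inductive component :: "ty \<Rightarrow> ty \<Rightarrow> bool" (infix "\<preceq>" 50) where
  refl: "A \<preceq> A"
| left: "A \<preceq> C \<Longrightarrow> A \<preceq> C \<^bold>\<inter> D"
| right: "A \<preceq> D \<Longrightarrow> A \<preceq> C \<^bold>\<inter> D"

lemma component_CapD: "A \<^bold>\<inter> B \<preceq> C \<Longrightarrow> A \<preceq> C \<and> B \<preceq> C"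
  by (induction "A \<^bold>\<inter> B" C rule: component.induct) (auto intro: component.intros)

text \<open>Intersecting the members one after another gives \<open>C\<close>; for the empty set any
  type will do.\<close>

lemma ex_common_Cap: "finite S \<Longrightarrow> \<exists>C. \<forall>A\<in>S. A \<preceq> C"
proof (induction S rule: finite_induct)
  case (insert A S)
  then obtain C where "\<forall>B\<in>S. B \<preceq> C" by blast
  then have "\<forall>B\<in>insert A S. B \<preceq> A \<^bold>\<inter> C" by (auto intro: component.intros)
  then show ?case by blast
qed simp

text \<open>\<open>\<rho>\<close> need not be injective, and one declaration of
  \<open>\<Delta>\<close> may serve several of \<open>\<Gamma>\<close>; the latter merges the types
  of a variable into one.\<close>

definition covers :: "(nat \<Rightarrow> nat) \<Rightarrow> ctx \<Rightarrow> ctx \<Rightarrow> bool" where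
  "covers \<rho> \<Gamma> \<Delta> \<longleftrightarrow> (\<forall>x A. (x, A) |\<in>| \<Gamma> \<longrightarrow> (\<exists>C. (\<rho> x, C) |\<in>| \<Delta> \<and> A \<preceq> C))"

lemma covers_finsert:
  "covers \<rho> (finsert (x, A) \<Gamma>) \<Delta> \<longleftrightarrow> (\<exists>C. (\<rho> x, C) |\<in>| \<Delta> \<and> A \<preceq> C) \<and> covers \<rho> \<Gamma> \<Delta>"
  unfolding covers_def by auto

lemma covers_mono: "covers \<rho> \<Gamma> \<Delta> \<Longrightarrow> \<Delta> |\<subseteq>| \<Delta>' \<Longrightarrow> covers \<rho> \<Gamma> \<Delta>'"
  unfolding covers_def by blast

lemma covers_id_subset: "\<Gamma> |\<subseteq>| \<Delta> \<Longrightarrow> covers (\<lambda>x. x) \<Gamma> \<Delta>"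
  unfolding covers_def by (auto intro: component.refl)

lemma covers_lift_ctx: "covers \<rho> \<Gamma> \<Delta> \<Longrightarrow> covers (up \<rho>) (lift_ctx \<Gamma>) (lift_ctx \<Delta>)"
  unfolding covers_def lift_ctx_def by (force simp: fimage_iff)

lemma covers_fun_upd: "fresh_ctx y \<Gamma> \<Longrightarrow> covers \<rho> \<Gamma> \<Delta> \<Longrightarrow> covers (\<rho>(y := z)) \<Gamma> \<Delta>"
  unfolding covers_def fresh_ctx_def by auto

text \<open>\<open>L_cap\<close>, read upwards, splits \<open>C\<close> until \<open>A\<close>
  appears. Each split adds declarations, hence the premise for all contexts above
  \<open>\<Delta>\<close>.\<close>

lemma typing_s_component:
  assumes "A \<preceq> C" and "(x, C) |\<in>| \<Delta>"
    and "\<And>\<Delta>'. \<Delta> |\<subseteq>| \<Delta>' \<Longrightarrow> (x, A) |\<in>| \<Delta>' \<Longrightarrow> \<Delta>' \<turnstile>\<^sub>s Var x \<degree>\<degree> Ns : B"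
  shows "\<Delta> \<turnstile>\<^sub>s Var x \<degree>\<degree> Ns : B"
  using assms
proof (induction arbitrary: \<Delta> rule: component.induct)
  case (refl A)
  then show ?case by blast
next
  case (left A C D)
  have "finsert (x, C) (finsert (x, D) \<Delta>) \<turnstile>\<^sub>s Var x \<degree>\<degree> Ns : B"
    by (rule left.IH) (use left.prems(2) in auto)
  \<comment> \<open>The split declaration already lies in \<open>\<Delta>\<close>, so
    \<open>L_cap\<close> concludes in \<open>\<Delta>\<close> itself.\<close>
  from L_cap [OF this] show ?case using left.prems(1) by (simp add: finsert_absorb)
next
  case (right A D C)
  have "finsert (x, C) (finsert (x, D) \<Delta>) \<turnstile>\<^sub>s Var x \<degree>\<degree> Ns : B"
    by (rule right.IH) (use right.prems(2) in auto)
  from L_cap [OF this] show ?case using right.prems(1) by (simp add: finsert_absorb)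
qed

text \<open>A larger context may declare the variable \<open>y\<close> of \<open>L_arrow\<close>,
  which has to be fresh. Treating renaming and weakening together lets \<open>y\<close> be exchanged
  for a fresh \<open>z\<close> within the induction.\<close>

lemma typing_s_rename: "\<Gamma> \<turnstile>\<^sub>s M : A \<Longrightarrow> covers \<rho> \<Gamma> \<Delta> \<Longrightarrow> \<Delta> \<turnstile>\<^sub>s rename \<rho> M : A"
proof (induction arbitrary: \<rho> \<Delta> rule: typing_s.induct)
  case (Ax x A \<Gamma>)
  then obtain C where C: "A \<preceq> C" "(\<rho> x, C) |\<in>| \<Delta>"
    by (auto simp: covers_finsert)
  have "\<Delta> \<turnstile>\<^sub>s Var (\<rho> x) \<degree>\<degree> [] : A"
    using C
  proof (rule typing_s_component)
    fix \<Delta>' assume "(\<rho> x, A) |\<in>| \<Delta>'"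
    then show "\<Delta>' \<turnstile>\<^sub>s Var (\<rho> x) \<degree>\<degree> [] : A"
      using typing_s.Ax [of "\<rho> x" A \<Delta>'] by (simp add: finsert_absorb)
  qed
  then show ?case by simp
next
  case (Beta \<Gamma> M N Ns A B)
  have "\<Delta> \<turnstile>\<^sub>s subst (rename (up \<rho>) M) (rename \<rho> N) 0 \<degree>\<degree> map (rename \<rho>) Ns : A"
    using Beta.IH(1) [OF Beta.prems] by (simp add: rename_subst)
  from typing_s.Beta [OF this Beta.IH(2) [OF Beta.prems]] show ?case by simp
next
  case (L_arrow \<Gamma> N A1 y A2 Ns B x)
  from L_arrow.prems obtain C where C: "A1 \<^bold>\<rightarrow> A2 \<preceq> C" "(\<rho> x, C) |\<in>| \<Delta>"
    and cov: "covers \<rho> \<Gamma> \<Delta>"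
    by (auto simp: covers_finsert)
  have "\<Delta> \<turnstile>\<^sub>s Var (\<rho> x) \<degree>\<degree> (rename \<rho> N # map (rename \<rho>) Ns) : B"
    using C
  proof (rule typing_s_component)
    fix \<Delta>' assume sub: "\<Delta> |\<subseteq>| \<Delta>'" and mem: "(\<rho> x, A1 \<^bold>\<rightarrow> A2) |\<in>| \<Delta>'"
    obtain z where z: "z \<notin> (\<Union>P\<in>set (map (rename \<rho>) Ns). FV P)" "fresh_ctx z \<Delta>'"
      using ex_fresh by blast
    have cov': "covers \<rho> \<Gamma> \<Delta>'"
      using cov sub by (rule covers_mono)
    have "covers (\<rho>(y := z)) \<Gamma> (finsert (z, A2) \<Delta>')"
      using covers_fun_upd [OF L_arrow.hyps(4) cov'] by (rule covers_mono) auto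
    then have "covers (\<rho>(y := z)) (finsert (y, A2) \<Gamma>) (finsert (z, A2) \<Delta>')"
      by (auto simp: covers_finsert intro: component.refl)
    from L_arrow.IH(2) [OF this]
    have "finsert (z, A2) \<Delta>' \<turnstile>\<^sub>s Var z \<degree>\<degree> map (rename (\<rho>(y := z))) Ns : B"
      by (simp only: rename_Apps rename.simps fun_upd_same)
    \<comment> \<open>\<open>y\<close> does not occur in \<open>Ns\<close>, so the update at
      \<open>y\<close> has no effect there.\<close>
    moreover have "map (rename (\<rho>(y := z))) Ns = map (rename \<rho>) Ns"
      using L_arrow.hyps(3) by (auto intro!: rename_cong)
    ultimately have "finsert (z, A2) \<Delta>' \<turnstile>\<^sub>s Var z \<degree>\<degree> map (rename \<rho>) Ns : B"
      by (simp only:)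
    from typing_s.L_arrow [OF L_arrow.IH(1) [OF cov'] this z, of "\<rho> x"] mem
    show "\<Delta>' \<turnstile>\<^sub>s Var (\<rho> x) \<degree>\<degree> (rename \<rho> N # map (rename \<rho>) Ns) : B"
      by (simp add: finsert_absorb)
  qed
  then show ?case by simp
next
  case (R_arrow A \<Gamma> M B)
  have "covers (up \<rho>) (lift_ctx \<Gamma>) (finsert (0, A) (lift_ctx \<Delta>))"
    using covers_lift_ctx [OF R_arrow.prems] by (rule covers_mono) auto
  then have "covers (up \<rho>) (finsert (0, A) (lift_ctx \<Gamma>)) (finsert (0, A) (lift_ctx \<Delta>))"
    by (auto simp: covers_finsert intro: component.refl)
  from R_arrow.IH [OF this] show ?case by (simp add: typing_s.R_arrow)
next
  case (L_cap x A1 A2 \<Gamma> Ns B)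
  then have "covers \<rho> (finsert (x, A1) (finsert (x, A2) \<Gamma>)) \<Delta>"
    by (auto simp: covers_finsert dest: component_CapD)
  from L_cap.IH [OF this] show ?case .
next
  case (R_cap \<Gamma> M A B)
  then show ?case by (simp add: typing_s.R_cap)
qed

lemma typing_s_covers: "\<Gamma> \<turnstile>\<^sub>s M : A \<Longrightarrow> covers (\<lambda>x. x) \<Gamma> \<Delta> \<Longrightarrow> \<Delta> \<turnstile>\<^sub>s M : A"
  using typing_s_rename [of \<Gamma> M A "\<lambda>x. x" \<Delta>] by (simp add: rename_id)

lemma typing_s_weaken: "\<Gamma> \<turnstile>\<^sub>s M : A \<Longrightarrow> \<Gamma> |\<subseteq>| \<Delta> \<Longrightarrow> \<Delta> \<turnstile>\<^sub>s M : A"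
  using typing_s_covers covers_id_subset by blast

section \<open>Typable terms\<close>

definition typable :: "trm \<Rightarrow> bool" where
  "typable M \<longleftrightarrow> (\<exists>\<Gamma> A. \<Gamma> \<turnstile>\<^sub>s M : A)"

lemma typable_common_ctx:
  "\<forall>N\<in>set Ns. typable N \<Longrightarrow> \<exists>\<Gamma>. \<forall>N\<in>set Ns. \<exists>A. \<Gamma> \<turnstile>\<^sub>s N : A"
proof (induction Ns)
  case (Cons N Ns)
  then obtain \<Gamma> \<Delta> A where "\<forall>N\<in>set Ns. \<exists>A. \<Gamma> \<turnstile>\<^sub>s N : A" "\<Delta> \<turnstile>\<^sub>s N : A"
    unfolding typable_def by auto
  moreover have "\<Gamma> |\<union>| \<Delta> \<turnstile>\<^sub>s P : B" if "\<Gamma> \<turnstile>\<^sub>s P : B \<or> \<Delta> \<turnstile>\<^sub>s P : B" for P B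
    using that typing_s_weaken by blast
  ultimately have "\<forall>P\<in>set (N # Ns). \<exists>A. \<Gamma> |\<union>| \<Delta> \<turnstile>\<^sub>s P : A"
    unfolding list.set by blast
  then show ?case by blast
qed simp

text \<open>\<open>R_arrow\<close> discharges a single type of index \<open>0\<close>, whereas
  \<open>\<Gamma>\<close> may give it several. A type \<open>C\<close> that has all of them as
  components becomes the argument type.\<close>

lemma typable_Lam:
  assumes "typable M"
  shows "typable (Lam M)"
proof -
  obtain \<Gamma> B where M: "\<Gamma> \<turnstile>\<^sub>s M : B"
    using assms unfolding typable_def by blast
  obtain C where C: "\<forall>A\<in>snd ` fset \<Gamma>. A \<preceq> C"
    using ex_common_Cap [of "snd ` fset \<Gamma>"] by auto
  \<comment> \<open>The context outside the binder. Since \<open>0 - 1 = 0\<close>, declarations of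
    index \<open>0\<close> land on the outer variable \<open>0\<close>; this surplus is harmless, as
    covering allows additional declarations.\<close>
  define \<Delta> where "\<Delta> = (\<lambda>(x, A). (x - 1, A)) |`| \<Gamma>"
  have "covers (\<lambda>x. x) \<Gamma> (finsert (0, C) (lift_ctx \<Delta>))"
    unfolding covers_def
  proof (intro allI impI)
    fix x A assume mem: "(x, A) |\<in>| \<Gamma>"
    show "\<exists>D. (x, D) |\<in>| finsert (0, C) (lift_ctx \<Delta>) \<and> A \<preceq> D"
    proof (cases x)
      case 0
      with mem C show ?thesis by force
    next
      case (Suc j)
      have "(j, A) |\<in>| \<Delta>"
        unfolding \<Delta>_def by (rule fimage_eqI [OF _ mem]) (simp add: Suc)
      then have "(Suc j, A) |\<in>| lift_ctx \<Delta>"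
        unfolding lift_ctx_def by (force simp: fimage_iff)
      with Suc show ?thesis by (auto intro: component.refl)
    qed
  qed
  from R_arrow [OF typing_s_covers [OF M this]] show ?thesis
    unfolding typable_def by blast
qed

text \<open>\<open>C\<close> is the iterated arrow from types of the arguments to \<open>B\<close>.
  It is chosen before \<open>x\<close>, so that the induction hypothesis applies to whichever fresh
  \<open>y\<close> is picked for \<open>L_arrow\<close>.\<close>

lemma typing_s_Var_Apps:
  assumes "\<forall>N\<in>set Ns. \<exists>A. \<Gamma> \<turnstile>\<^sub>s N : A"
  shows "\<exists>C. \<forall>x. finsert (x, C) \<Gamma> \<turnstile>\<^sub>s Var x \<degree>\<degree> Ns : B"
  using assms
proof (induction Ns)
  case Nil
  show ?case by (auto intro: Ax)
next
  case (Cons N Ns)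
  then obtain A C where N: "\<Gamma> \<turnstile>\<^sub>s N : A"
    and C: "\<And>x. finsert (x, C) \<Gamma> \<turnstile>\<^sub>s Var x \<degree>\<degree> Ns : B"
    by auto
  obtain y where "y \<notin> (\<Union>P\<in>set Ns. FV P)" "fresh_ctx y \<Gamma>"
    using ex_fresh by blast
  from L_arrow [OF N C this] show ?case by auto
qed

lemma typable_Var_Apps: "\<forall>N\<in>set Ns. typable N \<Longrightarrow> typable (Var x \<degree>\<degree> Ns)"
  using typable_common_ctx typing_s_Var_Apps unfolding typable_def by metis

text \<open>Both premises of \<open>Beta\<close> are weakened to the union of their contexts.
  \<open>N\<close> has to be typed separately because the substitution may erase it.\<close>

lemma typable_Beta:
  assumes "typable (subst M N 0 \<degree>\<degree> Ns)" and "typable N"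
  shows "typable (App (Lam M) N \<degree>\<degree> Ns)"
proof -
  obtain \<Gamma> \<Delta> A B where "\<Gamma> \<turnstile>\<^sub>s subst M N 0 \<degree>\<degree> Ns : A" "\<Delta> \<turnstile>\<^sub>s N : B"
    using assms unfolding typable_def by blast
  then have "\<Gamma> |\<union>| \<Delta> \<turnstile>\<^sub>s subst M N 0 \<degree>\<degree> Ns : A" "\<Gamma> |\<union>| \<Delta> \<turnstile>\<^sub>s N : B"
    using typing_s_weaken funion_upper1 funion_upper2 by metis+
  from Beta [OF this] show ?thesis unfolding typable_def by blast
qed

section \<open>Induction along reductions and subterms\<close>

text \<open>Induction down the left spine: a further argument is appended to \<open>Ns\<close>, and
  an abstraction that receives one becomes a head redex.\<close>

lemma trm_head_cases:
  obtains (Lam) M' where "M = Lam M'"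
    | (Var) x Ns where "M = Var x \<degree>\<degree> Ns"
    | (Redex) P N Ns where "M = App (Lam P) N \<degree>\<degree> Ns"
proof (induction M arbitrary: thesis)
  case (Var x)
  show ?case by (rule Var(2) [of x "[]"]) simp
next
  case (App M N)
  show ?case
  proof (rule App.IH(1))
    fix M' assume "M = Lam M'"
    then show thesis by (intro App.prems(3) [of M' N "[]"]) simp
  next
    fix x Ns assume "M = Var x \<degree>\<degree> Ns"
    then show thesis by (intro App.prems(2) [of x "Ns @ [N]"]) simp
  next
    fix P Q Ns assume "M = App (Lam P) Q \<degree>\<degree> Ns"
    then show thesis by (intro App.prems(3) [of P Q "Ns @ [N]"]) simp
  qed
next
  case (Lam M)
  show ?case by (rule Lam.prems(1)) simp
qed

inductive subterm :: "trm \<Rightarrow> trm \<Rightarrow> bool" where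
  refl: "subterm M M"
| appL: "subterm (App N P) M \<Longrightarrow> subterm N M"
| appR: "subterm (App N P) M \<Longrightarrow> subterm P M"
| lam: "subterm (Lam N) M \<Longrightarrow> subterm N M"

text \<open>The step is first made in the immediate superterm by congruence; the induction
  hypothesis then carries it outwards to \<open>M\<close>.\<close>

lemma subterm_beta:
  "subterm N M \<Longrightarrow> N \<rightarrow>\<^sub>\<beta> N' \<Longrightarrow> \<exists>M'. M \<rightarrow>\<^sub>\<beta> M' \<and> subterm N' M'"
proof (induction arbitrary: N' rule: subterm.induct)
  case (refl M)
  then show ?case by (blast intro: subterm.refl)
next
  case (appL N P M)
  then show ?case using beta.appL subterm.appL by blast
next
  case (appR N P M)
  then show ?case using beta.appR subterm.appR by blast
next
  case (lam N M)
  then show ?case using beta.lam subterm.lam by blast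
qed

lemma subterm_Apps_head: "subterm (N \<degree>\<degree> Ns) M \<Longrightarrow> subterm N M"
  by (induction Ns arbitrary: N) (auto dest: subterm.appL)

lemma subterm_Apps_arg: "subterm (N \<degree>\<degree> Ns) M \<Longrightarrow> P \<in> set Ns \<Longrightarrow> subterm P M"
proof (induction Ns arbitrary: N)
  case (Cons Q Ns)
  then have "subterm (App N Q) M" using subterm_Apps_head by simp
  then have "subterm Q M" by (rule subterm.appR)
  with Cons show ?case by auto
qed simp

lemma size_Apps_head: "size N \<le> size (N \<degree>\<degree> Ns)"
proof (induction Ns arbitrary: N)
  case (Cons P Ns)
  have "size (App N P) \<le> size (App N P \<degree>\<degree> Ns)" by (rule Cons)
  then show ?case by simp
qed simp

lemma size_Apps_arg: "P \<in> set Ns \<Longrightarrow> size P < size (N \<degree>\<degree> Ns)"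
proof (induction Ns arbitrary: N)
  case (Cons Q Ns)
  have "size Q < size (App N Q \<degree>\<degree> Ns)"
    using size_Apps_head [of "App N Q" Ns] by simp
  with Cons show ?case by auto
qed simp

lemma beta_Apps: "M \<rightarrow>\<^sub>\<beta> M' \<Longrightarrow> M \<degree>\<degree> Ns \<rightarrow>\<^sub>\<beta> M' \<degree>\<degree> Ns"
  by (induction Ns arbitrary: M M') (auto intro: beta.appL)

text \<open>A term that is not accessible has a reduct that is not; choosing such reducts forever
  yields an infinite reduction.\<close>

lemma strongly_normalising_accp:
  assumes "strongly_normalising M"
  shows "Wellfounded.accp (\<lambda>N' N. N \<rightarrow>\<^sub>\<beta> N') M"
proof (rule ccontr)
  let ?R = "\<lambda>N' N. N \<rightarrow>\<^sub>\<beta> N'"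
  assume "\<not> Wellfounded.accp ?R M"
  moreover have "\<exists>N'. \<not> Wellfounded.accp ?R N' \<and> N \<rightarrow>\<^sub>\<beta> N'" if "\<not> Wellfounded.accp ?R N" for N
    using that accp.intros [of ?R N] by blast
  ultimately have "\<exists>f. f 0 = M \<and> (\<forall>n. \<not> Wellfounded.accp ?R (f n) \<and> f n \<rightarrow>\<^sub>\<beta> f (Suc n))"
    \<comment> \<open>The clause on \<open>n = 0\<close> makes the chosen sequence start at
      \<open>M\<close>.\<close>
    using dependent_nat_choice [of "\<lambda>n N. \<not> Wellfounded.accp ?R N \<and> (n = 0 \<longrightarrow> N = M)"
        "\<lambda>n N N'. N \<rightarrow>\<^sub>\<beta> N'"] by auto
  then show False using assms unfolding strongly_normalising_def by blast
qed

text \<open>Speaking of all subterms provides for the argument of a head redex, which the head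
  reduct may have lost.\<close>

lemma accp_beta_subterm_typable:
  "Wellfounded.accp (\<lambda>N' N. N \<rightarrow>\<^sub>\<beta> N') M \<Longrightarrow> subterm N M \<Longrightarrow> typable N"
proof (induction arbitrary: N rule: accp.induct)
  case (accI M)
  \<comment> \<open>The reduct of a subterm may be larger than the subterm, but it lies in a reduct
    of \<open>M\<close>, where the outer hypothesis holds.\<close>
  have outer: "typable N'" if "subterm N M" "N \<rightarrow>\<^sub>\<beta> N'" for N N'
    using subterm_beta [OF that] accI.IH by blast
  from \<open>subterm N M\<close> show ?case
  proof (induction N rule: measure_induct_rule [of size])
    case (less N)
    show ?case
    proof (cases N rule: trm_head_cases)
      case (Lam P)
      with less.prems have "subterm P M" using subterm.lam by blast
      with Lam have "typable P" by (intro less.IH) simp_all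
      with Lam show ?thesis by (simp add: typable_Lam)
    next
      case (Var x Ns)
      have "typable P" if "P \<in> set Ns" for P
      proof (rule less.IH)
        show "size P < size N" unfolding Var using that by (rule size_Apps_arg)
        show "subterm P M" using less.prems that unfolding Var by (rule subterm_Apps_arg)
      qed
      with Var show ?thesis by (simp add: typable_Var_Apps)
    next
      case (Redex P Q Ns)
      have "N \<rightarrow>\<^sub>\<beta> subst P Q 0 \<degree>\<degree> Ns"
        unfolding Redex by (rule beta_Apps) (rule beta.contract)
      with less.prems have "typable (subst P Q 0 \<degree>\<degree> Ns)" by (rule outer)
      moreover have "typable Q"
      proof (rule less.IH)
        \<comment> \<open>Seen this way, \<open>Q\<close> is one of the arguments, and the lemmas on
          arguments apply to it.\<close>
        have N: "N = Lam P \<degree>\<degree> (Q # Ns)" and Q: "Q \<in> set (Q # Ns)"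
          using Redex by simp_all
        show "size Q < size N" unfolding N using Q by (rule size_Apps_arg)
        show "subterm Q M" using less.prems Q unfolding N by (rule subterm_Apps_arg)
      qed
      ultimately show ?thesis unfolding Redex by (rule typable_Beta)
    qed
  qed
qed

theorem theorem4:
  fixes M :: trm
  assumes "strongly_normalising M"
  shows "\<exists>(\<Gamma> :: ctx) (A :: ty). \<Gamma> \<turnstile>\<^sub>s M : A"
  using accp_beta_subterm_typable [OF strongly_normalising_accp [OF assms] subterm.refl]
  unfolding typable_def .

end
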